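(* Let $k$ be a positive integer that is not a perfect square, let $d$ be the nearest integer to $\sqrt{k}$ (that is, $d=\lfloor \sqrt{k}+1/2\rfloor$), and let $f(x)=\dfrac{dx+k}{x+d}$. If $R=\dfrac{4d^2}{k-d^2}$ is an integer, then every iterate $f^n(\infty)$, $n\ge1$, is a convergent of the simple continued fraction expansion of $\sqrt{k}$.
   Context: $f$ acts on $\mathbb{R}\cup\{\infty\}$ with $f(\infty)=d$, and $f^n$ is its $n$-fold composite. If $\sqrt{k}=[c_0;c_1,c_2,\dots]$ is the simple continued fraction expansion, its convergents are the rationals $[c_0;c_1,\dots,c_j]$, $j\ge0$. *)

theory Defs
  imports Complex_Main "HOL-Computational_Algebra.Nth_Powers"
begin

text \<open>
  The map \<open>x \<mapsto> (d x + k) / (x + d)\<close> on the extended real line \<open>\<real> \<union> {\<infinity>}\<close>, with \<open>None\<close> as the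
  point at infinity. The pole \<open>-d\<close> is sent to infinity.
\<close>
definition mobius_map :: "real \<Rightarrow> real \<Rightarrow> real option \<Rightarrow> real option" where
  "mobius_map d k z = (case z of
      None \<Rightarrow> Some d
    | Some x \<Rightarrow> if x + d = 0 then None else Some ((d * x + k) / (x + d)))"

fun cf_complete_quotient :: "real \<Rightarrow> nat \<Rightarrow> real" where
  "cf_complete_quotient x 0 = x"
| "cf_complete_quotient x (Suc n) = 1 / frac (cf_complete_quotient x n)"

text \<open>
  The partial quotients \<open>c\<^sub>n\<close> of \<open>x = [c\<^sub>0; c\<^sub>1, c\<^sub>2, \<dots>]\<close>. This is meant for irrational \<open>x\<close>, where no
  complete quotient is an integer and the expansion never terminates.
\<close>
definition cf_partial_quotient :: "real \<Rightarrow> nat \<Rightarrow> int" where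
  "cf_partial_quotient x n = \<lfloor>cf_complete_quotient x n\<rfloor>"

text \<open>The value of \<open>[a\<^sub>0; a\<^sub>1, \<dots>, a\<^sub>j]\<close>; the value at the empty list is irrelevant.\<close>
fun cf_value :: "int list \<Rightarrow> real" where
  "cf_value [] = 0"
| "cf_value [a] = of_int a"
| "cf_value (a # b # as) = of_int a + 1 / cf_value (b # as)"

definition cf_convergent :: "real \<Rightarrow> nat \<Rightarrow> real" where
  "cf_convergent x j = cf_value (map (cf_partial_quotient x) [0..<Suc j])"

end

theory Submission
  imports Defs
begin

text \<open>
  Write \<open>(d + \<surd>k)\<^sup>n = p + q\<surd>k\<close> and \<open>e = k - d\<^sup>2\<close>; then \<open>f\<^sup>n(\<infinity>) = p / q\<close> and \<open>p\<^sup>2 - k q\<^sup>2 = (-e)\<^sup>n\<close>.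
  Since \<open>e\<close> divides \<open>4 d\<^sup>2\<close>, the number \<open>(d + \<surd>k)\<^sup>2 / e\<close> has integral trace and norm 1, so that
  \<open>e\<^sup>m\<close> divides \<open>p\<close> and \<open>q\<close> for \<open>n = 2 m + 1\<close>, and \<open>gcd e (2 d) \<cdot> e\<^sup>m\<close> divides them for
  \<open>n = 2 m + 2\<close>. After cancellation the norm is at most \<open>\<bar>e\<bar>\<close> in absolute value, and \<open>\<bar>e\<bar> < \<surd>k\<close>
  because \<open>d\<close> is the integer nearest to \<open>\<surd>k\<close>. A fraction of norm less than \<open>\<surd>k\<close> is a convergent.
\<close>

section \<open>Convergents and unimodular matrices\<close>

text \<open>The definition produces complete quotients one after another at the far end. The
  Euclidean descent below strips the first partial quotient instead, so the recursion is needed from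
  the front.\<close>

lemma cf_complete_quotient_Suc_shift:
  "cf_complete_quotient x (Suc n) = cf_complete_quotient (1 / frac x) n"
  by (induction n) auto

lemma cf_convergent_0: "cf_convergent x 0 = \<lfloor>x\<rfloor>"
  by (simp add: cf_convergent_def cf_partial_quotient_def)

lemma cf_convergent_Suc:
  "cf_convergent x (Suc j) = \<lfloor>x\<rfloor> + 1 / cf_convergent (1 / frac x) j"
proof -
  have "map (cf_partial_quotient x) [0..<Suc (Suc j)] =
      \<lfloor>x\<rfloor> # map (cf_partial_quotient x \<circ> Suc) [0..<Suc j]"
    by (simp only: upt_conv_Cons[of 0 "Suc (Suc j)"] map_Suc_upt[symmetric] zero_less_Suc list.map map_map)
       (simp add: cf_partial_quotient_def)
  also have "cf_partial_quotient x \<circ> Suc = cf_partial_quotient (1 / frac x)"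
    by (simp add: fun_eq_iff cf_partial_quotient_def cf_complete_quotient_Suc_shift
        del: cf_complete_quotient.simps)
  finally show ?thesis
    by (simp add: cf_convergent_def upt_conv_Cons del: upt_Suc)
qed

lemma cf_convergent_of_floor_eq:
  assumes "of_int b < x" "x < of_int b + 1" "cf_convergent (1 / (x - of_int b)) j = y"
  shows "cf_convergent x (Suc j) = of_int b + 1 / y"
proof -
  have "\<lfloor>x\<rfloor> = b"
    using assms by linarith
  thus ?thesis
    using assms by (simp add: cf_convergent_Suc frac_def)
qed

text \<open>
  The case \<open>q' = 0\<close> is where the Euclidean descent on \<open>(p, q)\<close> may end; \<open>p' = -1\<close> must be excluded
  there, as \<open>p\<close> need not be a convergent of \<open>p - 1 / \<alpha>\<close>.
\<close>
lemma cf_convergent_of_unimodular: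
  fixes x \<alpha> :: real and p q p' q' :: int
  assumes "\<bar>p * q' - p' * q\<bar> = 1" "q \<ge> 1" "\<alpha> > 1"
    and "1 \<le> q' \<and> q' \<le> q \<or> q' = 0 \<and> p' = 1 \<and> q = 1"
    and "x = (p * \<alpha> + p') / (q * \<alpha> + q')"
  shows "\<exists>j. of_int p / of_int q = cf_convergent x j"
  using assms
proof (induction "nat q" arbitrary: p q p' q' x rule: less_induct)
  case less
  note IH = less.hyps and det = less.prems(1) and q1 = less.prems(2) and \<alpha> = less.prems(3)
    and q' = less.prems(4) and x = less.prems(5)
  show ?case
  proof (cases "q = 1")
    case q: True
    consider "q' = 0" "p' = 1" | "q' = 1" "p' = p + 1" | "q' = 1" "p' = p - 1"
      using q' det q by (auto simp: abs_if split: if_splits)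
    then show ?thesis
    proof cases
      case 1
      hence "x = p + 1 / \<alpha>" using q x \<alpha> by (simp add: field_simps)
      moreover have "0 < 1 / \<alpha>" "1 / \<alpha> < 1" using \<alpha> by auto
      ultimately have "\<lfloor>x\<rfloor> = p" by linarith
      thus ?thesis using q by (intro exI[of _ 0]) (simp add: cf_convergent_0)
    next
      case 2
      hence "x = p + 1 / (\<alpha> + 1)" using q x \<alpha> by (simp add: field_simps)
      moreover have "0 < 1 / (\<alpha> + 1)" "1 / (\<alpha> + 1) < 1" using \<alpha> by auto
      ultimately have "\<lfloor>x\<rfloor> = p" by linarith
      thus ?thesis using q by (intro exI[of _ 0]) (simp add: cf_convergent_0)
    next
      \<comment> \<open>Here x = [p - 1; 1, \<open>\<alpha>\<close>] lies below p, so p = (p - 1) +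
        1/1 is convergent number 1 rather than 0.\<close>
      case 3
      hence eq: "x - of_int (p - 1) = \<alpha> / (\<alpha> + 1)" using q x \<alpha> by (simp add: field_simps)
      have less_1: "0 < \<alpha> / (\<alpha> + 1)" "\<alpha> / (\<alpha> + 1) < 1" using \<alpha> by auto
      have "1 / (x - of_int (p - 1)) = 1 + 1 / \<alpha>"
        unfolding eq using \<alpha> by (simp add: field_simps)
      moreover have "0 < 1 / \<alpha>" "1 / \<alpha> < 1" using \<alpha> by auto
      ultimately have "\<lfloor>1 / (x - of_int (p - 1))\<rfloor> = 1" by linarith
      hence "cf_convergent (1 / (x - of_int (p - 1))) 0 = 1" by (simp add: cf_convergent_0)
      hence "cf_convergent x (Suc 0) = of_int (p - 1) + 1 / 1"
        using eq less_1 by (intro cf_convergent_of_floor_eq) auto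
      thus ?thesis using q by (intro exI[of _ "Suc 0"]) simp
    qed
  next
    case False
    hence q2: "q \<ge> 2" using q1 by simp
    have q'1: "1 \<le> q'" using q' False by auto
    \<comment> \<open>Euclidean step: subtracting \<open>b\<close> and inverting takes p/q to q/r
      and the matrix with rows (p, p'), (q, q') to the one with rows (q, q'), (r, r'). The tail
      \<open>\<alpha>\<close> stays the same.\<close>
    define b r r' where "b = p div q" and "r = p mod q" and "r' = p' - b * q'"
    have p: "p = b * q + r" by (simp add: b_def r_def)
    have r_ge: "0 \<le> r" and r_less: "r < q" using q2 by (auto simp: r_def)
    have det_r: "\<bar>r * q' - r' * q\<bar> = 1"
      using det by (simp add: p r'_def algebra_simps)
    have "r \<noteq> 0"
    proof
      assume "r = 0"
      hence "\<bar>r'\<bar> * q = 1" using det_r q2 by (simp add: abs_mult)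
      thus False using q2 by (simp add: zmult_eq_1_iff)
    qed
    hence r1: "1 \<le> r" using r_ge by simp
    have "q' \<noteq> q"
    proof
      assume "q' = q"
      hence "\<bar>r - r'\<bar> * q = 1"
        using det_r q2 by (simp add: left_diff_distrib[symmetric] abs_mult)
      thus False using q2 by (simp add: zmult_eq_1_iff)
    qed
    hence q'_less: "q' < q" using q' False by auto
    \<comment> \<open>As \<open>r' * q\<close> differs from \<open>r * q'\<close> by 1 and q is at
      least 2, the bounds on \<open>r\<close> and \<open>q'\<close> carry over to \<open>r'\<close>.
      The bound by \<open>r\<close> feeds the induction; the bound by \<open>q'\<close> makes x - b
      less than 1, so that \<open>b\<close> is the floor of x.\<close>
    have "(- 1) * q < r' * q"
      using det_r q2 mult_mono[of 1 r 1 q'] r1 q'1 by linarith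
    hence r'_ge: "0 \<le> r'"
      using q2 by (subst (asm) mult_less_cancel_right) auto
    have "r * q' \<le> r * (q - 1)" using q'_less r1 by (intro mult_left_mono) auto
    hence "r' * q < (r + 1) * q"
      using det_r q2 r1 by (simp add: algebra_simps)
    hence r'_le_r: "r' \<le> r"
      using q2 by (subst (asm) mult_less_cancel_right) auto
    have "r * q' \<le> (q - 1) * q'" using r_less q'1 by (intro mult_right_mono) auto
    hence "r' * q < (q' + 1) * q"
      using det_r q2 q'1 by (simp add: algebra_simps)
    hence r'_le_q': "r' \<le> q'"
      using q2 by (subst (asm) mult_less_cancel_right) auto
    have r'_cases: "1 \<le> r' \<and> r' \<le> r \<or> r' = 0 \<and> q' = 1 \<and> r = 1"
    proof (cases "r' = 0")
      case True
      hence "r * q' = 1" using det_r r1 q'1 by (simp add: abs_mult)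
      thus ?thesis using True r1 q'1 by (auto simp: zmult_eq_1_iff)
    qed (use r'_ge r'_le_r in auto)
    have num_pos: "0 < r * \<alpha> + r'"
      using r1 r'_ge \<alpha> by (intro add_pos_nonneg mult_pos_pos) auto
    have den_pos: "0 < q * \<alpha> + q'"
      using q2 q'1 \<alpha> by (intro add_pos_nonneg mult_pos_pos) auto
    have num_less: "r * \<alpha> + r' < q * \<alpha> + q'"
      using r_less r'_le_q' \<alpha> by (intro add_less_le_mono mult_strict_right_mono) auto
    have eq: "x - b = (r * \<alpha> + r') / (q * \<alpha> + q')"
      using den_pos unfolding x p r'_def by (simp add: field_simps)
    have "\<exists>j. of_int q / of_int r = cf_convergent (1 / (x - b)) j"
    proof (rule IH[of r q r' q'])
      show "nat r < nat q" using r_less r1 by simp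
      show "\<bar>q * r' - q' * r\<bar> = 1" using det_r by (simp add: algebra_simps abs_minus_commute)
      show "1 / (x - b) = (q * \<alpha> + q') / (r * \<alpha> + r')" by (simp add: eq)
    qed (use r1 \<alpha> r'_cases in auto)
    then obtain j where "cf_convergent (1 / (x - b)) j = of_int q / of_int r" by metis
    moreover have "0 < x - b" "x - b < 1"
      unfolding eq using num_pos den_pos num_less by auto
    ultimately have "cf_convergent x (Suc j) = b + 1 / (of_int q / of_int r)"
      by (intro cf_convergent_of_floor_eq) auto
    thus ?thesis using p q2 by (intro exI[of _ "Suc j"]) (simp add: field_simps)
  qed
qed

section \<open>Fractions of small norm are convergents of sqrt D\<close>

text \<open>A Bezout solution may be shifted by multiples of (p, q), which moves q' into any window
  of length q. The window starts at 1 because the descent above needs a positive q'.\<close>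

lemma exists_unimodular_completion:
  fixes p q \<epsilon> :: int
  assumes "coprime p q" "q > 0"
  obtains p' q' where "p * q' - p' * q = \<epsilon>" "1 \<le> q'" "q' \<le> q"
proof -
  obtain u v where uv: "u * p + v * q = 1"
    using bezout_int[of p q] assms by auto
  define t where "t = (\<epsilon> * u - 1) div q"
  define q' where "q' = \<epsilon> * u - q * t"
  define p' where "p' = - \<epsilon> * v - p * t"
  have "q' - 1 = (\<epsilon> * u - 1) mod q"
    by (simp add: q'_def t_def minus_mult_div_eq_mod [symmetric])
  hence "0 \<le> q' - 1" "q' - 1 < q" using assms by simp_all
  moreover have "p * q' - p' * q = \<epsilon> * (u * p + v * q)"
    by (simp add: p'_def q'_def algebra_simps)
  ultimately show ?thesis using uv by (intro that[of q' p']) auto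
qed

text \<open>Complete (p, q) to a matrix of determinant \<open>\<epsilon>\<close> and solve sqrt D =
  (p \<open>\<alpha>\<close> + p') / (q \<open>\<alpha>\<close> + q') for \<open>\<alpha>\<close>.
  This forces q \<open>\<alpha>\<close> + q' = 1 / \<open>\<delta>\<close>, so
  \<open>\<alpha>\<close> > 1 means \<open>\<delta>\<close> (q + q') < 1. Since
  \<open>\<delta>\<close> (p + q sqrt D) = M, that amounts to M (q + q') < p + q sqrt D.\<close>

lemma cf_convergent_sqrt_of_small_norm_coprime:
  fixes p q :: int and D :: nat
  assumes "coprime p q" "p > 0" "q > 0" "p\<^sup>2 \<noteq> int D * q\<^sup>2"
    and small: "\<bar>of_int (p\<^sup>2 - int D * q\<^sup>2)\<bar> < sqrt (real D)"
  shows "\<exists>j. of_int p / of_int q = cf_convergent (sqrt (real D)) j"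
proof -
  define s where "s = sqrt (real D)"
  define M where "M = \<bar>p\<^sup>2 - int D * q\<^sup>2\<bar>"
  \<comment> \<open>The sign of the norm is also that of p - q s, so \<open>\<delta>\<close> is the
    absolute value of p - q s.\<close>
  define \<epsilon> :: int where "\<epsilon> = (if p\<^sup>2 > int D * q\<^sup>2 then 1 else -1)"
  define \<delta> where "\<delta> = \<epsilon> * (p - q * s)"
  have s2: "s * s = D" by (simp add: s_def)
  have M1: "M \<ge> 1" using assms by (simp add: M_def)
  have M_s: "M < s" using small by (simp add: M_def s_def)
  have s_pos: "s > 0" using M_s M1 by linarith
  have M_eq: "M = \<epsilon> * (p\<^sup>2 - int D * q\<^sup>2)" by (simp add: M_def \<epsilon>_def)
  have sum_pos: "0 < p + q * s" using assms s_pos by (simp add: add_pos_pos)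
  have \<delta>_sum: "\<delta> * (p + q * s) = M"
  proof -
    have "\<delta> * (p + q * s) = \<epsilon> * (p * p - q * q * (s * s))"
      by (simp add: \<delta>_def algebra_simps)
    thus ?thesis unfolding s2 M_eq by (simp add: power2_eq_square algebra_simps)
  qed
  have \<delta>_pos: "\<delta> > 0"
  proof -
    have "0 < \<delta> * (p + q * s)" unfolding \<delta>_sum using M1 by simp
    thus ?thesis using sum_pos by (rule zero_less_mult_pos2)
  qed
  have \<epsilon>2: "\<epsilon> * \<epsilon> = 1" by (simp add: \<epsilon>_def)
  obtain p' q' where det: "p * q' - p' * q = \<epsilon>" and q': "1 \<le> q'" "q' \<le> q"
    using exists_unimodular_completion assms by blast
  have "M * (q + q') < p + q * s"
  proof (cases "\<epsilon> = 1")
    case True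
    hence "q * s < p" using \<delta>_pos by (simp add: \<delta>_def)
    moreover have "real_of_int M * (q + q') \<le> real_of_int M * (2 * q)"
      using q' M1 by (intro mult_left_mono) auto
    moreover have "real_of_int M * (2 * q) < s * (2 * q)"
      using M_s assms by (intro mult_strict_right_mono) auto
    ultimately show ?thesis by (simp add: algebra_simps)
  next
    case False
    hence M_neg: "p\<^sup>2 = int D * q\<^sup>2 - M" using M_eq by (auto simp: \<epsilon>_def split: if_splits)
    \<comment> \<open>Now p < q s, and M < s alone does not bound p below by M q. Integrality does:
      D is at least M^2 + 1, and then p <= M q - 1 would contradict the size of p^2.\<close>
    have "real_of_int M * M < s * s" using M_s M1 by (intro mult_strict_mono) auto
    hence "M * M < int D" unfolding s2 by (metis of_int_less_iff of_int_mult of_int_of_nat_eq)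
    hence "(M * M + 1) * q\<^sup>2 \<le> int D * q\<^sup>2" by (intro mult_right_mono) auto
    hence ge: "p\<^sup>2 \<ge> (M * q)\<^sup>2 + q\<^sup>2 - M" using M_neg by (simp add: algebra_simps power2_eq_square)
    have "p \<ge> M * q"
    proof (rule ccontr)
      assume "\<not> p \<ge> M * q"
      hence "p\<^sup>2 \<le> (M * q - 1)\<^sup>2" using assms by (intro power_mono) auto
      hence "q\<^sup>2 + 2 * (M * q) \<le> M + 1" using ge by (simp add: power2_diff)
      moreover have "M * 1 \<le> M * q" using M1 assms by (intro mult_left_mono) auto
      moreover have "q\<^sup>2 > 0" using assms by simp
      ultimately show False using M1 by linarith
    qed
    moreover have "M * q' \<le> M * q" using q' M1 by (intro mult_left_mono) auto
    ultimately have "real_of_int (M * q') \<le> p" by linarith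
    moreover have "real_of_int M * q < s * q" using M_s assms by (intro mult_strict_right_mono) auto
    ultimately show ?thesis by (simp add: algebra_simps)
  qed
  moreover have "M * (q + q') = \<delta> * (q + q') * (p + q * s)"
    by (simp add: \<delta>_sum[symmetric] mult_ac)
  ultimately have "\<delta> * (q + q') * (p + q * s) < 1 * (p + q * s)" by (simp only: mult_1_left)
  hence small': "\<delta> * (q + q') < 1" using sum_pos by (simp only: mult_less_cancel_right_pos)
  define \<alpha> where "\<alpha> = (1 / \<delta> - q') / q"
  have "q + q' < 1 / \<delta>" using small' \<delta>_pos by (simp add: field_simps)
  hence \<alpha>1: "\<alpha> > 1" unfolding \<alpha>_def using assms by (simp add: field_simps)
  have den: "q * \<alpha> + q' = 1 / \<delta>" using assms by (simp add: \<alpha>_def)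
  have "q * (p * \<alpha> + p') = p * (q * \<alpha> + q') - (p * q' - p' * q)"
    by (simp add: algebra_simps)
  also have "\<dots> = p / \<delta> - \<epsilon>" unfolding den det[symmetric] by simp
  also have "\<dots> = (p - \<epsilon> * \<delta>) / \<delta>" using \<delta>_pos by (simp add: field_simps)
  also have "\<epsilon> * \<delta> = real_of_int (\<epsilon> * \<epsilon>) * (p - q * s)" by (simp add: \<delta>_def)
  finally have "q * (p * \<alpha> + p') = q * (s / \<delta>)" by (simp add: \<epsilon>2)
  hence "p * \<alpha> + p' = s / \<delta>" by (rule mult_left_cancel[THEN iffD1, rotated]) (use assms in simp)
  hence "s = (p * \<alpha> + p') / (q * \<alpha> + q')" using den \<delta>_pos by simp
  moreover have "\<bar>p * q' - p' * q\<bar> = 1" using det by (simp add: \<epsilon>_def)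
  ultimately show ?thesis
    unfolding s_def[symmetric] using q' \<alpha>1 assms by (intro cf_convergent_of_unimodular[where \<alpha> = \<alpha>]) auto
qed

text \<open>Reducing P/Q to lowest terms divides the norm by the square of the gcd, which is at
  least g^2.\<close>

lemma cf_convergent_sqrt_of_small_norm:
  fixes P Q g :: int and D :: nat
  assumes "P > 0" "Q > 0" "P\<^sup>2 \<noteq> int D * Q\<^sup>2" "g dvd P" "g dvd Q"
    and small: "\<bar>of_int (P\<^sup>2 - int D * Q\<^sup>2)\<bar> < of_int (g\<^sup>2) * sqrt (real D)"
  shows "\<exists>j. of_int P / of_int Q = cf_convergent (sqrt (real D)) j"
proof -
  define G where "G = gcd P Q"
  have G: "G > 0" using assms by (simp add: G_def)
  obtain p q where PQ: "P = p * G" "Q = q * G" and "coprime p q"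
    using gcd_coprime_exists[of P Q] G unfolding G_def by (metis less_irrefl)
  have "g dvd G" using assms by (simp add: G_def)
  hence "\<bar>g\<bar> \<le> \<bar>G\<bar>" using G by (intro dvd_imp_le_int) auto
  hence "g\<^sup>2 \<le> G\<^sup>2" by (simp add: abs_le_square_iff)
  have norm: "P\<^sup>2 - int D * Q\<^sup>2 = G\<^sup>2 * (p\<^sup>2 - int D * q\<^sup>2)"
    by (simp add: PQ power2_eq_square algebra_simps)
  have "real_of_int (g\<^sup>2) * sqrt (real D) \<le> of_int (G\<^sup>2) * sqrt (real D)"
    using \<open>g\<^sup>2 \<le> G\<^sup>2\<close> by (intro mult_right_mono) (simp_all only: of_int_le_iff real_sqrt_ge_zero of_nat_0_le_iff)
  hence "of_int (G\<^sup>2) * \<bar>of_int (p\<^sup>2 - int D * q\<^sup>2)\<bar> < of_int (G\<^sup>2) * sqrt (real D)"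
    using small unfolding norm by (simp add: abs_mult)
  hence "\<bar>of_int (p\<^sup>2 - int D * q\<^sup>2)\<bar> < sqrt (real D)"
    by (rule mult_left_less_imp_less) simp
  moreover have "p > 0" "q > 0" using assms G by (auto simp: PQ zero_less_mult_iff)
  moreover have "p\<^sup>2 \<noteq> int D * q\<^sup>2" using norm assms by auto
  ultimately have "\<exists>j. of_int p / of_int q = cf_convergent (sqrt (real D)) j"
    using \<open>coprime p q\<close> by (intro cf_convergent_sqrt_of_small_norm_coprime)
  thus ?thesis using G by (simp add: PQ)
qed

section \<open>Powers of d + sqrt k and the iterates of f\<close>

text \<open>The pair \<open>(p, q)\<close> with \<open>(d + \<surd>k)\<^sup>n = p + q\<surd>k\<close>.\<close>
fun sqrt_power_coeffs :: "int \<Rightarrow> int \<Rightarrow> nat \<Rightarrow> int \<times> int" where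
  "sqrt_power_coeffs d k 0 = (1, 0)"
| "sqrt_power_coeffs d k (Suc n) =
    (let (p, q) = sqrt_power_coeffs d k n in (d * p + k * q, p + d * q))"

lemma sqrt_power_coeffs_norm:
  "(fst (sqrt_power_coeffs d k n))\<^sup>2 - k * (snd (sqrt_power_coeffs d k n))\<^sup>2 = (d\<^sup>2 - k) ^ n"
proof (induction n)
  case (Suc n)
  obtain p q where pq: "sqrt_power_coeffs d k n = (p, q)" by fastforce
  \<comment> \<open>Multiplicativity of the norm, for the factor d + sqrt k.\<close>
  have "(d * p + k * q)\<^sup>2 - k * (p + d * q)\<^sup>2 = (d\<^sup>2 - k) * (p\<^sup>2 - k * q\<^sup>2)"
    by (simp add: power2_eq_square algebra_simps)
  thus ?case using Suc pq by simp
qed auto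

lemma sqrt_power_coeffs_pos:
  assumes "d > 0" "k > 0"
  shows "fst (sqrt_power_coeffs d k (Suc n)) > 0 \<and> snd (sqrt_power_coeffs d k (Suc n)) > 0"
  using assms
  by (induction n) (auto simp: case_prod_beta Let_def intro!: add_pos_pos)

text \<open>Multiplication by d + sqrt k acts on the ratio p/q as f. The start (1, 0) represents
  infinity, so the formula begins at the first iterate; from there on positivity keeps p/q away from
  the pole -d.\<close>

lemma mobius_map_iterate:
  assumes "d > 0" "k > 0"
  shows "(mobius_map (of_int d) (of_int k) ^^ Suc n) None =
    Some (of_int (fst (sqrt_power_coeffs d k (Suc n))) / of_int (snd (sqrt_power_coeffs d k (Suc n))))"
proof (induction n)
  case 0
  show ?case by (simp add: mobius_map_def)
next
  case (Suc n)
  obtain p q where pq: "sqrt_power_coeffs d k (Suc n) = (p, q)" by fastforce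
  have pos: "p > 0" "q > 0" using sqrt_power_coeffs_pos[OF assms, of n] pq by auto
  have "real_of_int p / real_of_int q + real_of_int d > 0"
    using pos assms by (intro add_pos_pos) auto
  hence "mobius_map (of_int d) (of_int k) (Some (of_int p / of_int q)) =
      Some ((of_int d * (of_int p / of_int q) + of_int k) / (of_int p / of_int q + of_int d))"
    by (simp add: mobius_map_def)
  also have "of_int d * (of_int p / of_int q) + of_int k = of_int (d * p + k * q) / real_of_int q"
    using pos by (simp add: field_simps)
  also have "of_int p / of_int q + of_int d = of_int (p + d * q) / real_of_int q"
    using pos by (simp add: field_simps)
  also have "of_int (d * p + k * q) / real_of_int q / (of_int (p + d * q) / real_of_int q) =
      of_int (d * p + k * q) / of_int (p + d * q)"
    using pos by simp
  finally show ?case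
    using Suc pq
    by (simp del: sqrt_power_coeffs.simps(2) add: sqrt_power_coeffs.simps(2)[of d k "Suc n"])
qed

text \<open>
  The recurrence is that of the powers of \<open>(d + \<surd>k)\<^sup>2\<close>, which has trace
  \<open>2 (d\<^sup>2 + k) = 4 d\<^sup>2 + 2 e\<close> and norm \<open>e\<^sup>2\<close>, where \<open>e = k - d\<^sup>2\<close>.
\<close>
lemma sqrt_power_coeffs_recurrence:
  fixes d k :: int
  defines "v \<equiv> sqrt_power_coeffs d k" and "e \<equiv> k - d\<^sup>2"
  shows "fst (v (n + 4)) = (4 * d\<^sup>2 + 2 * e) * fst (v (n + 2)) - e\<^sup>2 * fst (v n)"
    and "snd (v (n + 4)) = (4 * d\<^sup>2 + 2 * e) * snd (v (n + 2)) - e\<^sup>2 * snd (v n)"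
proof -
  have two: "v (m + 2) = ((d\<^sup>2 + k) * fst (v m) + 2 * d * k * snd (v m),
      2 * d * fst (v m) + (d\<^sup>2 + k) * snd (v m))" for m
    by (simp add: v_def case_prod_beta Let_def power2_eq_square algebra_simps)
  have four: "n + 4 = (n + 2) + 2" by simp
  show "fst (v (n + 4)) = (4 * d\<^sup>2 + 2 * e) * fst (v (n + 2)) - e\<^sup>2 * fst (v n)"
    and "snd (v (n + 4)) = (4 * d\<^sup>2 + 2 * e) * snd (v (n + 2)) - e\<^sup>2 * snd (v n)"
    unfolding four two[of "n + 2"] two[of n] fst_conv snd_conv e_def
    by (simp_all add: power2_eq_square algebra_simps)
qed

section \<open>Common divisors of the coefficients\<close>

text \<open>With trace divisible by e and norm e^2, each step gains a factor e. The induction also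
  carries a claim on \<open>e * x m\<close>, which avoids the exponent m - 1.\<close>

lemma dvd_of_second_order_recurrence:
  fixes x :: "nat \<Rightarrow> int"
  assumes rec: "\<And>m. x (m + 2) = e * t * x (m + 1) - e\<^sup>2 * x m"
    and "c dvd e * x 0" "c dvd x 1"
  shows "c * e ^ m dvd x (m + 1)"
proof -
  have "c * e ^ m dvd e * x m \<and> c * e ^ m dvd x (m + 1)"
  proof (induction m)
    case 0
    show ?case using assms by simp
  next
    case (Suc m)
    have eq: "x (Suc m + 1) = e * (t * x (m + 1) - e * x m)"
      using rec[of m] by (simp add: power2_eq_square algebra_simps)
    have "e * (c * e ^ m) dvd e * (t * x (m + 1) - e * x m)"
      using Suc by (intro mult_dvd_mono[OF dvd_refl] dvd_diff dvd_mult[of _ "x (m + 1)"]) auto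
    moreover have "e * (c * e ^ m) dvd e * x (m + 1)"
      using Suc by (intro mult_dvd_mono[OF dvd_refl]) auto
    moreover have "c * e ^ Suc m = e * (c * e ^ m)" by simp
    ultimately show ?case unfolding eq by (simp only: Suc_eq_plus1)
  qed
  thus ?thesis ..
qed

text \<open>Every second pair obeys the preceding recurrence with t = R + 2, so only starting values
  have to be checked: the third power with c = e for odd exponents, the second with c = gcd e (2 d)
  for even ones.\<close>

lemma dvd_sqrt_power_coeffs:
  fixes d k :: int
  defines "v \<equiv> sqrt_power_coeffs d k" and "e \<equiv> k - d\<^sup>2"
  assumes "e dvd 4 * d\<^sup>2"
  shows "e ^ m dvd fst (v (2 * m + 1)) \<and> e ^ m dvd snd (v (2 * m + 1))"
    and "gcd e (2 * d) * e ^ m dvd fst (v (2 * m + 2)) \<and> gcd e (2 * d) * e ^ m dvd snd (v (2 * m + 2))"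
proof -
  have k: "k = d\<^sup>2 + e" by (simp add: e_def)
  obtain R where R: "4 * d\<^sup>2 = e * R" using assms(3) by (elim dvdE)
  have trace: "4 * d\<^sup>2 + 2 * e = e * (R + 2)" unfolding R by (simp add: algebra_simps)
  have recurrence:
    "fst (v (2 * (m + 2) + i)) = e * (R + 2) * fst (v (2 * (m + 1) + i)) - e\<^sup>2 * fst (v (2 * m + i))"
    "snd (v (2 * (m + 2) + i)) = e * (R + 2) * snd (v (2 * (m + 1) + i)) - e\<^sup>2 * snd (v (2 * m + i))"
    for m i
    using sqrt_power_coeffs_recurrence[of d k "2 * m + i", folded v_def e_def] unfolding trace
    by (simp_all add: algebra_simps eval_nat_numeral del: power_Suc)
  \<comment> \<open>Both pairs are expressed through d and e, grouped so that divisibility can be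
    read off term by term.\<close>
  have v2: "v 2 = (d * (2 * d) + e, 2 * d)"
    by (simp add: v_def k eval_nat_numeral algebra_simps)
  have v3: "v 3 = (d * (4 * d\<^sup>2) + 3 * d * e, 4 * d\<^sup>2 + e)"
    by (simp add: v_def k eval_nat_numeral algebra_simps)
  show "e ^ m dvd fst (v (2 * m + 1)) \<and> e ^ m dvd snd (v (2 * m + 1))"
  proof (cases m)
    case (Suc l)
    have "e dvd fst (v 3)" "e dvd snd (v 3)"
      using assms(3) unfolding v3 fst_conv snd_conv by (auto intro: dvd_add dvd_mult)
    hence "e * e ^ l dvd fst (v (2 * (l + 1) + 1))" "e * e ^ l dvd snd (v (2 * (l + 1) + 1))"
      by (intro dvd_of_second_order_recurrence[where x = "\<lambda>m. fst (v (2 * m + 1))", OF recurrence(1)]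
          dvd_of_second_order_recurrence[where x = "\<lambda>m. snd (v (2 * m + 1))", OF recurrence(2)];
          simp add: eval_nat_numeral)+
    thus ?thesis by (simp add: Suc)
  qed simp
  define h where "h = gcd e (2 * d)"
  have h: "h dvd e" "h dvd 2 * d" by (auto simp: h_def)
  hence "h dvd fst (v 2)" "h dvd snd (v 2)"
    unfolding v2 fst_conv snd_conv by (auto intro: dvd_add dvd_mult)
  hence "h * e ^ m dvd fst (v (2 * (m + 1) + 0))" "h * e ^ m dvd snd (v (2 * (m + 1) + 0))"
    using h
    by (intro dvd_of_second_order_recurrence[where x = "\<lambda>m. fst (v (2 * m + 0))", OF recurrence(1)]
        dvd_of_second_order_recurrence[where x = "\<lambda>m. snd (v (2 * m + 0))", OF recurrence(2)];
        simp add: eval_nat_numeral)+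
  thus "gcd e (2 * d) * e ^ m dvd fst (v (2 * m + 2)) \<and> gcd e (2 * d) * e ^ m dvd snd (v (2 * m + 2))"
    by (simp add: h_def)
qed

text \<open>Each term of the squared Bezout combination is a multiple of e, hence e divides the
  square of the gcd. With a = 2 d this pays for the factor of e still missing when the exponent is
  even.\<close>

lemma abs_le_gcd_square:
  fixes e a :: int
  assumes "e dvd a\<^sup>2" "e \<noteq> 0"
  shows "\<bar>e\<bar> \<le> (gcd e a)\<^sup>2"
proof -
  obtain u v where uv: "gcd e a = u * e + v * a"
    using bezout_int[of e a] by metis
  have "(gcd e a)\<^sup>2 = e * (u\<^sup>2 * e + 2 * u * v * a) + v\<^sup>2 * a\<^sup>2"
    unfolding uv by (simp add: power2_eq_square algebra_simps)
  hence "e dvd (gcd e a)\<^sup>2" using assms by simp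
  thus ?thesis using assms dvd_imp_le_int[of "(gcd e a)\<^sup>2" e] by simp
qed

text \<open>The inequality says that a norm of size \<open>\<bar>e\<bar> ^ n\<close> drops to at
  most \<open>\<bar>e\<bar>\<close> once g is cancelled. It is an equality for the g chosen at odd
  n.\<close>

lemma common_divisor_sqrt_power_coeffs:
  fixes d k :: int
  defines "v \<equiv> sqrt_power_coeffs d k" and "e \<equiv> k - d\<^sup>2"
  assumes "e dvd 4 * d\<^sup>2" "e \<noteq> 0" "n \<ge> 1"
  obtains g where "g dvd fst (v n)" "g dvd snd (v n)" "g \<noteq> 0" "\<bar>e\<bar> ^ n \<le> g\<^sup>2 * \<bar>e\<bar>"
proof (cases "odd n")
  case True
  then obtain m where m: "n = 2 * m + 1" by (elim oddE)
  have "\<bar>e\<bar> ^ n = (e ^ m)\<^sup>2 * \<bar>e\<bar>"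
    by (simp add: m power_mult power_even_abs flip: power_mult_distrib power_mult)
      (simp add: mult.commute power_mult)
  thus ?thesis
    using dvd_sqrt_power_coeffs(1)[of k d m] assms m by (intro that[of "e ^ m"]) auto
next
  case False
  then obtain m' where "n = 2 * m'" by auto
  with assms(5) obtain m where m: "n = 2 * m + 2" by (cases m') auto
  define h where "h = gcd e (2 * d)"
  have "\<bar>e\<bar> \<le> h\<^sup>2"
    unfolding h_def using assms by (intro abs_le_gcd_square) (auto simp: power_mult_distrib)
  hence "(e ^ m)\<^sup>2 * (\<bar>e\<bar> * \<bar>e\<bar>) \<le> (e ^ m)\<^sup>2 * (h\<^sup>2 * \<bar>e\<bar>)"
    by (intro mult_left_mono mult_right_mono) auto
  moreover have "\<bar>e\<bar> ^ n = (e ^ m)\<^sup>2 * (\<bar>e\<bar> * \<bar>e\<bar>)"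
    by (simp add: m power_add power_mult power2_eq_square power_mult_distrib)
  ultimately have "\<bar>e\<bar> ^ n \<le> (h * e ^ m)\<^sup>2 * \<bar>e\<bar>"
    by (simp add: power_mult_distrib mult_ac)
  thus ?thesis
    using dvd_sqrt_power_coeffs(2)[of k d m] assms m
    by (intro that[of "h * e ^ m"]) (auto simp: h_def)
qed

section \<open>The nearest integer to sqrt k, and the conclusion\<close>

text \<open>Squaring d - 1/2 <= sqrt k < d + 1/2 and rounding to integers gives d^2 - d + 1 <= k <=
  d^2 + d. The difference is at most d < sqrt k if k exceeds d^2, and otherwise at most d - 1, which
  is below sqrt k since d <= sqrt k + 1/2.\<close>

lemma abs_diff_nearest_square_less:
  fixes k :: nat and d :: int
  assumes "d = \<lfloor>sqrt (real k) + 1 / 2\<rfloor>" "k > 0" "int k \<noteq> d\<^sup>2"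
  shows "\<bar>of_int (int k - d\<^sup>2)\<bar> < sqrt (real k)" "d > 0"
proof -
  define s where "s = sqrt (real k)"
  have s2: "s * s = k" by (simp add: s_def)
  have s1: "s \<ge> 1" using assms by (simp add: s_def)
  have d_le: "d \<le> s + 1 / 2" and d_gt: "s + 1 / 2 < d + 1"
    using assms(1) unfolding s_def by linarith+
  show d1: "d > 0" using d_gt s1 by linarith
  have "s * s < (d + 1 / 2) * (d + 1 / 2)" using d_gt s1 by (intro mult_strict_mono) auto
  hence "real_of_int (int k) < of_int (d * d + d + 1)" unfolding s2 by (simp add: algebra_simps)
  hence upper: "int k \<le> d * d + d" unfolding of_int_less_iff by simp
  have "(d - 1 / 2) * (d - 1 / 2) \<le> s * s" using d_le d1 s1 by (intro mult_mono) auto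
  hence "real_of_int (d * d - d) < of_int (int k)" unfolding s2 by (simp add: algebra_simps)
  hence lower: "d * d - d + 1 \<le> int k" unfolding of_int_less_iff by simp
  show "\<bar>of_int (int k - d\<^sup>2)\<bar> < sqrt (real k)"
  proof (cases "int k > d\<^sup>2")
    case True
    hence "sqrt (real_of_int (d\<^sup>2)) < sqrt (real_of_int (int k))"
      by (simp only: real_sqrt_less_iff of_int_less_iff)
    hence "d < s" using d1 by (simp add: s_def)
    moreover have "\<bar>int k - d\<^sup>2\<bar> \<le> d" using upper True by (simp add: power2_eq_square)
    ultimately show ?thesis unfolding s_def by linarith
  next
    case False
    hence "\<bar>int k - d\<^sup>2\<bar> \<le> d - 1" using lower assms by (simp add: power2_eq_square)
    thus ?thesis using d_le unfolding s_def by linarith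
  qed
qed

theorem theorem2p4:
  fixes k :: nat and d :: int and f :: "real option \<Rightarrow> real option"
  assumes "k > 0" and "\<not> is_square k"
    and "d = \<lfloor>sqrt (real k) + 1 / 2\<rfloor>"
    and "f = mobius_map (real_of_int d) (real k)"
    and "4 * (real_of_int d)\<^sup>2 / (real k - (real_of_int d)\<^sup>2) \<in> \<int>"
  shows "\<forall>n\<ge>1. \<exists>j. (f ^^ n) None = Some (cf_convergent (sqrt (real k)) j)"
proof (intro allI impI)
  fix n :: nat
  assume n: "n \<ge> 1"
  define e where "e = int k - d\<^sup>2"
  have "int k \<noteq> d\<^sup>2"
  proof
    assume "int k = d\<^sup>2"
    hence "k = (nat \<bar>d\<bar>)\<^sup>2" by (metis nat_int nat_power_eq abs_ge_zero power2_abs)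
    thus False using assms(2) by (auto simp: is_nth_power_def)
  qed
  hence e0: "e \<noteq> 0" by (simp add: e_def)
  note near = abs_diff_nearest_square_less[OF assms(3,1) \<open>int k \<noteq> d\<^sup>2\<close>]
  have real_e: "real k - (real_of_int d)\<^sup>2 = of_int e" by (simp add: e_def)
  \<comment> \<open>Integrality of R is turned into divisibility of 4 d^2 by e.\<close>
  obtain R where "4 * (real_of_int d)\<^sup>2 / of_int e = of_int R"
    using assms(5) unfolding real_e by (elim Ints_cases)
  hence "real_of_int (4 * d\<^sup>2) = of_int (e * R)" using e0 by (simp add: field_simps)
  hence e_dvd: "e dvd 4 * d\<^sup>2" by (metis of_int_eq_iff dvd_triv_left)
  define P Q where "P = fst (sqrt_power_coeffs d (int k) n)" and "Q = snd (sqrt_power_coeffs d (int k) n)"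
  obtain n' where n': "n = Suc n'" using n by (cases n) auto
  have pos: "P > 0" "Q > 0"
    unfolding P_def Q_def n' using near assms(1) sqrt_power_coeffs_pos[of d "int k" n'] by simp_all
  have norm: "P\<^sup>2 - int k * Q\<^sup>2 = (- e) ^ n"
    unfolding P_def Q_def sqrt_power_coeffs_norm by (simp add: e_def)
  obtain g where g: "g dvd P" "g dvd Q" "g \<noteq> 0" "\<bar>e\<bar> ^ n \<le> g\<^sup>2 * \<bar>e\<bar>"
    using common_divisor_sqrt_power_coeffs[of "int k" d n] e_dvd e0 n
    unfolding P_def Q_def e_def by blast
  have "\<bar>P\<^sup>2 - int k * Q\<^sup>2\<bar> \<le> g\<^sup>2 * \<bar>e\<bar>"
    unfolding norm using g by (simp add: power_abs)
  hence "\<bar>of_int (P\<^sup>2 - int k * Q\<^sup>2)\<bar> \<le> real_of_int (g\<^sup>2) * \<bar>of_int e\<bar>"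
    by (metis of_int_abs of_int_le_iff of_int_mult)
  also have "\<dots> < of_int (g\<^sup>2) * sqrt (real k)"
    using near g unfolding e_def by (intro mult_strict_left_mono) auto
  finally have "\<exists>j. of_int P / of_int Q = cf_convergent (sqrt (real k)) j"
    using pos g norm e0 by (intro cf_convergent_sqrt_of_small_norm) auto
  moreover have "(f ^^ n) None = Some (of_int P / of_int Q)"
    unfolding assms(4) n' P_def Q_def using mobius_map_iterate[of d "int k" n'] near assms(1) by simp
  ultimately show "\<exists>j. (f ^^ n) None = Some (cf_convergent (sqrt (real k)) j)" by simp
qed

end
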